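(* Let $d,\alpha>1$ and let $1\le k\le n$ be integers, and fix a constant $\beta\ge 1$. There is a random linear map $G:\mathbb{R}^d\to\mathbb{R}^t$ with target dimension $t=O(\log k+\tfrac{d}{\alpha^2})$ (the hidden constant may depend on $\beta$) such that for every set $P\subset\mathbb{R}^d$ of size $n$, with probability at least $2/3$: (1) $\mathrm{OPT}_{vanilla}(G(P))$ is an $O(\alpha)$-estimation of $\mathrm{OPT}_{vanilla}(P)$; and (2) every set $C\subset P$ of size $k$ is an $O(\alpha)$-approximate vanilla $k$-center solution of $P$ whenever $G(C)$ is a $\beta$-approximate vanilla $k$-center solution of $G(P)$.
   Context: All norms are Euclidean. For $x\in\mathbb{R}^m$ and finite $C\subset\mathbb{R}^m$, $\mathrm{dist}(x,C)=\min_{c\in C}\|x-c\|$. For a finite set $X\subset\mathbb{R}^m$, the vanilla $k$-center value is $\mathrm{OPT}_{vanilla}(X)=\min_{C\subset\mathbb{R}^m,|C|=k}\max_{x\in X}\mathrm{dist}(x,C)$. For $X\subset\mathbb{R}^d$, $G(X)=\{Gx:x\in X\}$. A set $C\subset X$ of size $k$ is a $\gamma$-approximate vanilla $k$-center solution of $X$ if $\max_{x\in X}\mathrm{dist}(x,C)\le\gamma\,\mathrm{OPT}_{vanilla}(X)$. A number $y$ is a $\gamma$-estimation of a number $x\ge 0$ if $x\le y\le\gamma x$. The $O(\cdot)$ notation hides universal constants (depending only on $\beta$).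
   Formalization: The target dimension is bounded by O(1 + log k + d/α²) instead of O(log k + d/α²), since for k = 1 and large α the literal bound would force t = 0, where claim (1) fails for any two distinct points. *)

theory Defs
  imports "HOL-Probability.Probability"
begin

definition Rn :: "nat \<Rightarrow> (nat \<Rightarrow> real) set" where
  "Rn m = {x. \<forall>i\<ge>m. x i = 0}"

definition enorm :: "nat \<Rightarrow> (nat \<Rightarrow> real) \<Rightarrow> real" where
  "enorm m x = sqrt (\<Sum>i<m. (x i)\<^sup>2)"

definition edist :: "nat \<Rightarrow> (nat \<Rightarrow> real) \<Rightarrow> (nat \<Rightarrow> real) \<Rightarrow> real" where
  "edist m x y = enorm m (\<lambda>i. x i - y i)"

text \<open>dist(x,C) = min over c in C of the distance (C finite, nonempty)\<close>
definition dist_to :: "nat \<Rightarrow> (nat \<Rightarrow> real) \<Rightarrow> (nat \<Rightarrow> real) set \<Rightarrow> real" where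
  "dist_to m x C = Min ((\<lambda>c. edist m x c) ` C)"

definition kcost :: "nat \<Rightarrow> (nat \<Rightarrow> real) set \<Rightarrow> (nat \<Rightarrow> real) set \<Rightarrow> real" where
  "kcost m X C = Max ((\<lambda>x. dist_to m x C) ` X)"

definition opt_vanilla :: "nat \<Rightarrow> nat \<Rightarrow> (nat \<Rightarrow> real) set \<Rightarrow> real" where
  "opt_vanilla k m X = Inf {kcost m X C | C. C \<subseteq> Rn m \<and> card C = k}"

definition approx_sol :: "nat \<Rightarrow> nat \<Rightarrow> (nat \<Rightarrow> real) set \<Rightarrow> (nat \<Rightarrow> real) set \<Rightarrow> real \<Rightarrow> bool" where
  "approx_sol k m X C \<gamma> \<longleftrightarrow> C \<subseteq> X \<and> card C = k \<and> kcost m X C \<le> \<gamma> * opt_vanilla k m X"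

definition is_estimation :: "real \<Rightarrow> real \<Rightarrow> real \<Rightarrow> bool" where
  "is_estimation x y \<gamma> \<longleftrightarrow> x \<le> y \<and> y \<le> \<gamma> * x"

definition apply_lin :: "nat \<Rightarrow> nat \<Rightarrow> (nat \<Rightarrow> nat \<Rightarrow> real) \<Rightarrow> (nat \<Rightarrow> real) \<Rightarrow> (nat \<Rightarrow> real)" where
  "apply_lin t d A x = (\<lambda>i. if i < t then (\<Sum>j<d. A i j * x j) else 0)"

end

theory Submission
  imports Defs
begin

text \<open>The map is a rescaled random sign matrix with \<open>t \<approx> log k + d / \<alpha>\<^sup>2\<close> rows. Its operator norm is
  \<open>O(sqrt (1 + d / t)) = O(\<alpha>)\<close>, so all distances in \<open>P\<close> grow by at most \<open>O(\<alpha>)\<close>, and with probability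
  \<open>1 - exp (- t / 12)\<close> a fixed vector is not contracted, which by a union bound covers \<open>O(k)\<close>
  prescribed points. Two families suffice: \<open>k + 1\<close> points at mutual distance at least \<open>OPT(P)\<close>, whose
  images force \<open>OPT(G(P)) \<ge> OPT(P)\<close>; and at most \<open>k\<close> points \<open>W\<close> such that each point of \<open>P\<close> is
  within \<open>2 OPT(P)\<close> of \<open>W\<close>. If \<open>G(p)\<close> and \<open>G(c)\<close> are \<open>O(\<alpha>) OPT(P)\<close> apart, then so are the images of
  their representatives in \<open>W\<close>, hence the representatives themselves, hence \<open>p\<close> and \<open>c\<close>.
  As the law is discrete, every event is measurable.\<close>

subsection \<open>Random sign matrices\<close>

text \<open>Hoeffding's auxiliary inequality with \<open>p = 1/2\<close> and
  \<open>h = 2 * |x|\<close>, exponentiated and multiplied by \<open>exp (- |x|)\<close>. It says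
  that a random sign is sub-Gaussian.\<close>

lemma cosh_le_exp_half_square: "cosh x \<le> exp (x\<^sup>2 / 2)" for x :: real
proof -
  have "- (2 * \<bar>x\<bar>) * (1/2) + ln (1 + (1/2) * (exp (2 * \<bar>x\<bar>) - 1)) \<le> (2 * \<bar>x\<bar>)\<^sup>2 / 8"
    by (rule Hoeffdings_lemma_aux) auto
  then have "ln ((1 + exp (2 * \<bar>x\<bar>)) / 2) \<le> \<bar>x\<bar> + x\<^sup>2 / 2"
    by (simp add: field_simps power_mult_distrib)
  then have "(1 + exp (2 * \<bar>x\<bar>)) / 2 \<le> exp (\<bar>x\<bar> + x\<^sup>2 / 2)"
    by (metis exp_ln exp_le_cancel_iff add_pos_pos half_gt_zero zero_less_one exp_gt_zero)
  then have "exp (- \<bar>x\<bar>) * ((1 + exp (2 * \<bar>x\<bar>)) / 2) \<le> exp (- \<bar>x\<bar>) * exp (\<bar>x\<bar> + x\<^sup>2 / 2)"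
    by (intro mult_left_mono) auto
  also have "exp (- \<bar>x\<bar>) * exp (\<bar>x\<bar> + x\<^sup>2 / 2) = exp (x\<^sup>2 / 2)"
    by (simp flip: exp_add)
  also have "exp (- \<bar>x\<bar>) * ((1 + exp (2 * \<bar>x\<bar>)) / 2) = cosh \<bar>x\<bar>"
    by (simp add: cosh_def field_simps flip: exp_add)
  finally show ?thesis by simp
qed

text \<open>The right-hand side times the Taylor polynomial \<open>1 + y + y^2 / 2\<close> equals
  \<open>1 + y^4 / 4\<close>, hence is at least 1, and that polynomial lies below
  \<open>exp y\<close>.\<close>

lemma exp_minus_le_quadratic:
  fixes y :: real
  assumes "y \<ge> 0"
  shows "exp (- y) \<le> 1 - y + y\<^sup>2 / 2"
proof -
  have pos: "0 < 1 + y + y\<^sup>2 / 2"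
    using assms by (simp add: add_pos_nonneg)
  have "(1 - y + y\<^sup>2 / 2) * (1 + y + y\<^sup>2 / 2) = 1 + y ^ 4 / 4"
    by (simp add: power2_eq_square power4_eq_xxxx field_simps)
  then have "1 \<le> (1 - y + y\<^sup>2 / 2) * (1 + y + y\<^sup>2 / 2)"
    by simp
  then have "1 / (1 + y + y\<^sup>2 / 2) \<le> 1 - y + y\<^sup>2 / 2"
    using pos by (simp add: pos_divide_le_eq)
  moreover have "exp (- y) \<le> 1 / (1 + y + y\<^sup>2 / 2)"
    unfolding exp_minus inverse_eq_divide
    using pos exp_lower_Taylor_quadratic[OF assms] by (intro divide_left_mono) auto
  ultimately show ?thesis
    by simp
qed

section \<open>The law of a random sign matrix and its moments\<close>

definition sign_pmf :: "real pmf" where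
  "sign_pmf = pmf_of_set {-1, 1}"

definition sign_vector :: "nat \<Rightarrow> (nat \<Rightarrow> real) pmf" where
  "sign_vector d = Pi_pmf {..<d} 0 (\<lambda>_. sign_pmf)"

text \<open>Rows are drawn as independent whole vectors, so expectations of products over rows
  factor. The default values make every entry outside the \<open>t\<close> by \<open>d\<close> block
  zero.\<close>

definition sign_matrix :: "nat \<Rightarrow> nat \<Rightarrow> (nat \<Rightarrow> nat \<Rightarrow> real) pmf" where
  "sign_matrix t d = Pi_pmf {..<t} (\<lambda>_. 0) (\<lambda>_. sign_vector d)"

text \<open>Finite support makes every real function integrable, which discharges the side
  conditions of linearity, monotonicity and Markov's inequality below.\<close>

lemma finite_set_Pi_pmf:
  assumes "finite A" "\<And>x. x \<in> A \<Longrightarrow> finite (set_pmf (p x))"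
  shows "finite (set_pmf (Pi_pmf A dflt p))"
  using assms by (subst set_Pi_pmf) (auto simp: o_def)

lemma finite_set_sign_pmf: "finite (set_pmf sign_pmf)"
  by (simp add: sign_pmf_def)

lemma finite_set_sign_vector: "finite (set_pmf (sign_vector d))"
  unfolding sign_vector_def by (intro finite_set_Pi_pmf finite_set_sign_pmf) auto

lemma finite_set_sign_matrix: "finite (set_pmf (sign_matrix t d))"
  unfolding sign_matrix_def by (intro finite_set_Pi_pmf finite_set_sign_vector) auto

lemma integrable_sign_pmf [simp]: "integrable (measure_pmf sign_pmf) (f :: _ \<Rightarrow> real)"
  by (rule integrable_measure_pmf_finite[OF finite_set_sign_pmf])

lemma integrable_sign_vector [simp]: "integrable (measure_pmf (sign_vector d)) (f :: _ \<Rightarrow> real)"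
  by (rule integrable_measure_pmf_finite[OF finite_set_sign_vector])

lemma integrable_sign_matrix [simp]: "integrable (measure_pmf (sign_matrix t d)) (f :: _ \<Rightarrow> real)"
  by (rule integrable_measure_pmf_finite[OF finite_set_sign_matrix])

lemma expectation_sign_pmf: "measure_pmf.expectation sign_pmf f = (f 1 + f (- 1)) / 2" for f :: "real \<Rightarrow> real"
  unfolding sign_pmf_def by (subst integral_pmf_of_set) auto

text \<open>By independence the moment generating function is the product of the factors
  \<open>cosh (v j)\<close>.\<close>

lemma expectation_exp_sign_vector:
  "measure_pmf.expectation (sign_vector d) (\<lambda>e. exp (\<Sum>j<d. e j * v j)) \<le> exp ((\<Sum>j<d. (v j)\<^sup>2) / 2)"
proof -
  have "measure_pmf.expectation (sign_vector d) (\<lambda>e. exp (\<Sum>j<d. e j * v j)) =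
        measure_pmf.expectation (sign_vector d) (\<lambda>e. \<Prod>j<d. exp (e j * v j))"
    by (simp add: exp_sum)
  also have "\<dots> = (\<Prod>j<d. measure_pmf.expectation sign_pmf (\<lambda>x. exp (x * v j)))"
    unfolding sign_vector_def by (rule expectation_prod_Pi_pmf) auto
  also have "\<dots> = (\<Prod>j<d. cosh (v j))"
    by (simp add: expectation_sign_pmf cosh_def)
  also have "\<dots> \<le> (\<Prod>j<d. exp ((v j)\<^sup>2 / 2))"
    by (intro prod_mono conjI cosh_le_exp_half_square) (simp add: cosh_real_nonneg)
  also have "\<dots> = exp ((\<Sum>j<d. (v j)\<^sup>2) / 2)"
    by (simp add: exp_sum sum_divide_distrib)
  finally show ?thesis .
qed

text \<open>Conditioning on the last sign turns both moment computations into inductions on the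
  dimension.\<close>

lemma expectation_sign_vector_Suc:
  fixes h :: "(nat \<Rightarrow> real) \<Rightarrow> real"
  shows "measure_pmf.expectation (sign_vector (Suc d)) h =
    measure_pmf.expectation (sign_vector d) (\<lambda>e. (h (e(d := 1)) + h (e(d := - 1))) / 2)"
proof -
  have "sign_vector (Suc d) = sign_pmf \<bind> (\<lambda>y. map_pmf (\<lambda>e. e(d := y)) (sign_vector d))"
    unfolding sign_vector_def lessThan_Suc by (subst Pi_pmf_insert') (auto simp: map_pmf_def)
  then show ?thesis
    unfolding sign_pmf_def
    by (subst pmf_expectation_bind_pmf_of_set | simp add: finite_set_sign_vector add_divide_distrib)+
qed

lemma sign_vector_second_moment:
  "measure_pmf.expectation (sign_vector d) (\<lambda>e. (\<Sum>j<d. e j * v j)\<^sup>2) = (\<Sum>j<d. (v j)\<^sup>2)"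
proof (induction d)
  case 0
  then show ?case by simp
next
  case (Suc d)
  have "((x + y)\<^sup>2 + (x - y)\<^sup>2) / 2 = x\<^sup>2 + y\<^sup>2" for x y :: real
    by (simp add: power2_eq_square algebra_simps)
  then show ?case
    using Suc by (simp add: expectation_sign_vector_Suc)
qed

lemma sign_vector_fourth_moment:
  "measure_pmf.expectation (sign_vector d) (\<lambda>e. (\<Sum>j<d. e j * v j) ^ 4) \<le> 3 * (\<Sum>j<d. (v j)\<^sup>2)\<^sup>2"
proof (induction d)
  case 0
  then show ?case by simp
next
  case (Suc d)
  have *: "((x + y) ^ 4 + (x - y) ^ 4) / 2 = x ^ 4 + 6 * y\<^sup>2 * x\<^sup>2 + y ^ 4" for x y :: real
    by (simp add: power2_eq_square power4_eq_xxxx algebra_simps)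
  have "measure_pmf.expectation (sign_vector (Suc d)) (\<lambda>e. (\<Sum>j<Suc d. e j * v j) ^ 4) =
        measure_pmf.expectation (sign_vector d) (\<lambda>e. (\<Sum>j<d. e j * v j) ^ 4)
        + 6 * (v d)\<^sup>2 * (\<Sum>j<d. (v j)\<^sup>2) + v d ^ 4"
    by (simp add: expectation_sign_vector_Suc * sign_vector_second_moment)
  \<comment> \<open>Enlarging \<open>v d ^ 4\<close> to three times itself completes the square of
    \<open>(\<Sum>j<d. (v j)^2) + (v d)^2\<close>.\<close>
  also have "\<dots> \<le> 3 * (\<Sum>j<d. (v j)\<^sup>2)\<^sup>2 + 6 * (v d)\<^sup>2 * (\<Sum>j<d. (v j)\<^sup>2) + 3 * v d ^ 4"
    using Suc by (intro add_mono) auto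
  also have "\<dots> = 3 * (\<Sum>j<Suc d. (v j)\<^sup>2)\<^sup>2"
    by (simp add: power2_eq_square power4_eq_xxxx algebra_simps)
  finally show ?case .
qed

text \<open>With \<open>\<lambda> / s\<close> in the exponent, the two moments bound the expectation
  by \<open>1 - \<lambda> + 3 * \<lambda>^2 / 2\<close>. This is smallest at
  \<open>\<lambda> = 1/3\<close>, whence the factor 3 and the value \<open>5 / 6\<close>.\<close>

lemma sign_vector_small_ball:
  assumes "s > 0" and s: "s = (\<Sum>j<d. (v j)\<^sup>2)"
  shows "measure_pmf.expectation (sign_vector d) (\<lambda>e. exp (- ((\<Sum>j<d. e j * v j)\<^sup>2 / (3 * s)))) \<le> 5 / 6"
proof -
  let ?E = "measure_pmf.expectation (sign_vector d)" and ?S = "\<lambda>e. \<Sum>j<d. e j * v j"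
  have "?E (\<lambda>e. exp (- ((?S e)\<^sup>2 / (3 * s)))) \<le> ?E (\<lambda>e. 1 - (?S e)\<^sup>2 / (3 * s) + ((?S e)\<^sup>2 / (3 * s))\<^sup>2 / 2)"
    using assms(1) by (intro integral_mono exp_minus_le_quadratic) auto
  also have "\<dots> = ?E (\<lambda>e. 1 - (?S e)\<^sup>2 / (3 * s) + (?S e) ^ 4 / (18 * s\<^sup>2))"
    by (simp add: power_divide power_mult_distrib flip: power_mult)
  also have "\<dots> = 1 - ?E (\<lambda>e. (?S e)\<^sup>2) / (3 * s) + ?E (\<lambda>e. (?S e) ^ 4) / (18 * s\<^sup>2)"
    by (subst Bochner_Integration.integral_add Bochner_Integration.integral_diff; simp)+
  also have "\<dots> \<le> 1 - s / (3 * s) + 3 * s\<^sup>2 / (18 * s\<^sup>2)"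
    using sign_vector_fourth_moment[where v = v and d = d] assms(1)
    unfolding sign_vector_second_moment s[symmetric]
    by (intro add_mono divide_right_mono) auto
  also have "\<dots> = 5 / 6"
    using assms(1) by simp
  finally show ?thesis .
qed

section \<open>Exponential tail bounds for sign matrices\<close>

text \<open>The bilinear form is a signed sum with coefficients \<open>u i * v j\<close>, whose
  squares add up to the product of the two squared norms. The parameter \<open>s\<close> stays free
  for the Chernoff argument.\<close>

lemma expectation_exp_sign_matrix:
  "measure_pmf.expectation (sign_matrix t d) (\<lambda>A. exp (s * (\<Sum>i<t. u i * (\<Sum>j<d. A i j * v j))))
    \<le> exp (s\<^sup>2 * (\<Sum>i<t. (u i)\<^sup>2) * (\<Sum>j<d. (v j)\<^sup>2) / 2)"
proof -
  have "measure_pmf.expectation (sign_matrix t d) (\<lambda>A. exp (s * (\<Sum>i<t. u i * (\<Sum>j<d. A i j * v j)))) =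
        measure_pmf.expectation (sign_matrix t d) (\<lambda>A. \<Prod>i<t. exp (\<Sum>j<d. A i j * (s * u i * v j)))"
    by (simp add: exp_sum sum_distrib_left mult_ac)
  also have "\<dots> = (\<Prod>i<t. measure_pmf.expectation (sign_vector d) (\<lambda>e. exp (\<Sum>j<d. e j * (s * u i * v j))))"
    unfolding sign_matrix_def by (rule expectation_prod_Pi_pmf) auto
  also have "\<dots> \<le> (\<Prod>i<t. exp ((\<Sum>j<d. (s * u i * v j)\<^sup>2) / 2))"
    by (intro prod_mono conjI expectation_exp_sign_vector integral_nonneg_AE) auto
  also have "\<dots> = exp (\<Sum>i<t. (\<Sum>j<d. (s * u i * v j)\<^sup>2) / 2)"
    by (simp add: exp_sum)
  also have "(\<Sum>i<t. (\<Sum>j<d. (s * u i * v j)\<^sup>2) / 2) = s\<^sup>2 * (\<Sum>i<t. (u i)\<^sup>2) * (\<Sum>j<d. (v j)\<^sup>2) / 2"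
    by (simp add: power_mult_distrib sum_distrib_left sum_distrib_right sum_divide_distrib mult_ac)
  finally show ?thesis .
qed

lemma sign_matrix_upper_tail:
  assumes Q: "(\<Sum>i<t. (u i)\<^sup>2) * (\<Sum>j<d. (v j)\<^sup>2) \<le> Q" and "Q > 0" "R \<ge> 0"
  shows "measure_pmf.prob (sign_matrix t d) {A. (\<Sum>i<t. u i * (\<Sum>j<d. A i j * v j)) > R}
    \<le> exp (- R\<^sup>2 / (2 * Q))"
proof -
  let ?B = "\<lambda>A. \<Sum>i<t. u i * (\<Sum>j<d. A i j * v j)"
  \<comment> \<open>This value minimises the Chernoff exponent
    \<open>s^2 * Q / 2 - s * R\<close>.\<close>
  define s where "s = R / Q"
  have s: "s \<ge> 0" using assms by (simp add: s_def)
  have "measure_pmf.prob (sign_matrix t d) {A. ?B A > R} \<le>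
        measure_pmf.prob (sign_matrix t d) {A \<in> space (measure_pmf (sign_matrix t d)). exp (s * ?B A) \<ge> exp (s * R)}"
    by (intro measure_pmf.finite_measure_mono) (auto intro: mult_left_mono s)
  also have "\<dots> \<le> measure_pmf.expectation (sign_matrix t d) (\<lambda>A. exp (s * ?B A)) / exp (s * R)"
    by (intro integral_Markov_inequality_measure) auto
  also have "\<dots> \<le> exp (s\<^sup>2 * Q / 2) / exp (s * R)"
  proof (intro divide_right_mono order.trans[OF expectation_exp_sign_matrix])
    show "exp (s\<^sup>2 * (\<Sum>i<t. (u i)\<^sup>2) * (\<Sum>j<d. (v j)\<^sup>2) / 2) \<le> exp (s\<^sup>2 * Q / 2)"
      using mult_left_mono[OF Q, of "s\<^sup>2"] by (simp add: mult.assoc)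
  qed auto
  also have "\<dots> = exp (- R\<^sup>2 / (2 * Q))"
    using \<open>Q > 0\<close> by (simp add: s_def power2_eq_square field_simps flip: exp_diff)
  finally show ?thesis .
qed

text \<open>Markov's inequality for the exponential of \<open>-1 / (3 * s)\<close> times the squared
  norm of the image, where \<open>s\<close> is the squared norm of \<open>v\<close>. Each row
  contributes at most \<open>5 / 6 \<le> exp (- 1 / 6)\<close>, while the threshold
  \<open>t * s / 4\<close> costs only \<open>exp (t / 12)\<close>.\<close>

lemma sign_matrix_lower_tail:
  "measure_pmf.prob (sign_matrix t d) {A. (\<Sum>i<t. (\<Sum>j<d. A i j * v j)\<^sup>2) < real t * (\<Sum>j<d. (v j)\<^sup>2) / 4}
    \<le> exp (- real t / 12)"
proof (cases "(\<Sum>j<d. (v j)\<^sup>2) > 0")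
  \<comment> \<open>For a vector of norm zero the strict inequality makes the event empty.\<close>
  case False
  then have "(\<Sum>j<d. (v j)\<^sup>2) = 0"
    by (meson sum_nonneg zero_le_power2 antisym_conv not_less)
  then have "{A. (\<Sum>i<t. (\<Sum>j<d. A i j * v j)\<^sup>2) < real t * (\<Sum>j<d. (v j)\<^sup>2) / 4} = {}"
    by (auto simp: not_less intro!: sum_nonneg)
  then show ?thesis by (simp only: measure_empty) simp
next
  case True
  define s where "s = (\<Sum>j<d. (v j)\<^sup>2)"
  have s: "s > 0" using True by (simp add: s_def)
  let ?S = "\<lambda>A i. \<Sum>j<d. A i j * v j"
  have "measure_pmf.prob (sign_matrix t d) {A. (\<Sum>i<t. (?S A i)\<^sup>2) < real t * s / 4} \<le>
        measure_pmf.prob (sign_matrix t d)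
          {A \<in> space (measure_pmf (sign_matrix t d)). exp (\<Sum>i<t. - ((?S A i)\<^sup>2 / (3 * s))) \<ge> exp (- real t / 12)}"
    using s by (intro measure_pmf.finite_measure_mono)
      (auto simp: sum_negf sum_divide_distrib[symmetric] field_simps)
  also have "\<dots> \<le> measure_pmf.expectation (sign_matrix t d) (\<lambda>A. exp (\<Sum>i<t. - ((?S A i)\<^sup>2 / (3 * s))))
      / exp (- real t / 12)"
    by (intro integral_Markov_inequality_measure) auto
  also have "measure_pmf.expectation (sign_matrix t d) (\<lambda>A. exp (\<Sum>i<t. - ((?S A i)\<^sup>2 / (3 * s)))) =
      measure_pmf.expectation (sign_matrix t d) (\<lambda>A. \<Prod>i<t. exp (- ((?S A i)\<^sup>2 / (3 * s))))"
    by (subst exp_sum) auto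
  also have "\<dots> = (\<Prod>i<t. measure_pmf.expectation (sign_vector d) (\<lambda>e. exp (- ((\<Sum>j<d. e j * v j)\<^sup>2 / (3 * s)))))"
    unfolding sign_matrix_def by (rule expectation_prod_Pi_pmf) auto
  also have "\<dots> \<le> (\<Prod>i<t. exp (- 1 / 6))"
  proof (intro prod_mono conjI integral_nonneg_AE order.trans[OF sign_vector_small_ball[OF s s_def]])
    have "exp (1 / 6 :: real) \<le> 1 + 1 / 6 + (1 / 6)\<^sup>2"
      by (rule exp_bound) auto
    then have "exp (1 / 6 :: real) \<le> 6 / 5"
      by (simp add: power2_eq_square)
    then show "5 / 6 \<le> exp (- 1 / 6 :: real)"
      by (simp add: exp_minus field_simps)
  qed auto
  also have "\<dots> = exp (- real t / 6)"
    by (simp flip: exp_of_nat_mult)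
  also have "exp (- real t / 6) / exp (- real t / 12) = exp (- real t / 12)"
    by (simp flip: exp_diff)
  finally show ?thesis
    by (simp add: s_def divide_right_mono)
qed

subsection \<open>Operator norms via an integer grid\<close>

lemma enorm_eq_L2_set: "enorm m x = L2_set x {..<m}"
  by (simp add: enorm_def L2_set_def)

lemma enorm_nonneg [simp]: "0 \<le> enorm m x"
  by (simp add: enorm_eq_L2_set)

lemma enorm_triangle: "enorm m (\<lambda>i. x i + y i) \<le> enorm m x + enorm m y"
  by (simp add: enorm_eq_L2_set L2_set_triangle_ineq)

lemma enorm_scale: "enorm m (\<lambda>i. c * x i) = \<bar>c\<bar> * enorm m x"
  by (simp add: enorm_def power_mult_distrib real_sqrt_mult flip: sum_distrib_left)

lemma enorm_square: "(enorm m x)\<^sup>2 = (\<Sum>i<m. (x i)\<^sup>2)"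
  by (simp add: enorm_def sum_nonneg)

lemma inner_le_enorm: "(\<Sum>i<m. x i * y i) \<le> enorm m x * enorm m y"
proof -
  have "(\<Sum>i<m. x i * y i) \<le> (\<Sum>i<m. \<bar>x i\<bar> * \<bar>y i\<bar>)"
    by (intro sum_mono) (metis abs_ge_self abs_mult)
  then show ?thesis
    unfolding enorm_eq_L2_set using L2_set_mult_ineq order.trans by blast
qed

text \<open>The integer points of the ball of radius \<open>2 * sqrt m\<close>. They sit in a box of
  extensional functions, so that finiteness and the factorisation of sums over \<open>PiE\<close>
  apply; from index \<open>m\<close> on their value is \<open>undefined\<close>.\<close>

definition int_grid :: "nat \<Rightarrow> (nat \<Rightarrow> int) set" where
  "int_grid m = {z \<in> {..<m} \<rightarrow>\<^sub>E {- (4 * int m)..4 * int m}. (\<Sum>i<m. (z i)\<^sup>2) \<le> 4 * int m}"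

lemma finite_int_grid: "finite (int_grid m)"
  unfolding int_grid_def by (rule finite_subset[of _ "{..<m} \<rightarrow>\<^sub>E {- (4 * int m)..4 * int m}"]) (auto intro: finite_PiE)

lemma sum_exp_minus_square_le: "(\<Sum>a\<in>{- int n..int n}. exp (- (real_of_int a)\<^sup>2)) \<le> 3"
proof -
  \<comment> \<open>The sharper bound makes the induction close: the two new terms together are at
    most \<open>2 * (1 / 2) ^ Suc n\<close>.\<close>
  have "(\<Sum>a\<in>{- int n..int n}. exp (- (real_of_int a)\<^sup>2)) \<le> 3 - 2 * (1 / 2) ^ n"
  proof (induction n)
    case (Suc n)
    have "{- int (Suc n)..int (Suc n)} = insert (int (Suc n)) (insert (- int (Suc n)) {- int n..int n})"
      by auto
    then have "(\<Sum>a\<in>{- int (Suc n)..int (Suc n)}. exp (- (real_of_int a)\<^sup>2)) =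
        2 * exp (- (real (Suc n))\<^sup>2) + (\<Sum>a\<in>{- int n..int n}. exp (- (real_of_int a)\<^sup>2))"
      by (simp add: power2_eq_square algebra_simps)
    moreover have "exp (- (real (Suc n))\<^sup>2) \<le> (1 / 2) ^ Suc n"
    proof -
      have "exp (- (real (Suc n))\<^sup>2) \<le> exp (real (Suc n) * (- 1))"
        by (simp add: power2_eq_square algebra_simps)
      also have "\<dots> = exp (- 1) ^ Suc n"
        by (rule exp_of_nat_mult)
      also have "\<dots> \<le> (1 / 2) ^ Suc n"
        using exp_ge_add_one_self[of 1] by (intro power_mono) (auto simp: exp_minus field_simps)
      finally show ?thesis .
    qed
    ultimately show ?case
      using Suc by simp
  qed simp
  then show ?thesis
    by (rule order.trans) simp
qed

text \<open>Every grid point has Gaussian weight \<open>exp (4 * m - |z|^2)\<close> at least 1, and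
  the total weight over the box factors into coordinates. Each factor is at most
  \<open>exp 4 * 3\<close>, and \<open>3 \<le> exp 2\<close>.\<close>

lemma card_int_grid: "real (card (int_grid m)) \<le> exp (6 * real m)"
proof -
  let ?I = "{- (4 * int m)..4 * int m}" and ?w = "\<lambda>a::int. exp (4 - (real_of_int a)\<^sup>2)"
  have "1 \<le> (\<Prod>i<m. ?w (z i))" if "z \<in> int_grid m" for z
  proof -
    have "real_of_int (\<Sum>i<m. (z i)\<^sup>2) \<le> real_of_int (4 * int m)"
      using that unfolding of_int_le_iff int_grid_def by simp
    then show ?thesis
      by (simp add: sum_subtractf flip: exp_sum)
  qed
  then have "real (card (int_grid m)) \<le> (\<Sum>z\<in>int_grid m. \<Prod>i<m. ?w (z i))"
    using sum_mono[of "int_grid m" "\<lambda>_. 1 :: real"] by simp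
  also have "\<dots> \<le> (\<Sum>z\<in>{..<m} \<rightarrow>\<^sub>E ?I. \<Prod>i<m. ?w (z i))"
    by (intro sum_mono2 finite_PiE prod_nonneg) (auto simp: int_grid_def)
  also have "\<dots> = (\<Prod>i<m. \<Sum>a\<in>?I. ?w a)"
    by (rule prod_sum_PiE[symmetric]) auto
  also have "(\<Sum>a\<in>?I. ?w a) = exp 4 * (\<Sum>a\<in>?I. exp (- (real_of_int a)\<^sup>2))"
    by (simp add: sum_distrib_left flip: exp_add)
  also have "(\<Prod>i<m. exp 4 * (\<Sum>a\<in>?I. exp (- (real_of_int a)\<^sup>2))) \<le> (\<Prod>i<m. exp 4 * exp 2)"
    using sum_exp_minus_square_le[of "4 * m"] exp_ge_add_one_self[of 2]
    by (intro prod_mono conjI mult_left_mono mult_nonneg_nonneg sum_nonneg) auto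
  also have "\<dots> = exp (6 * real m)"
    using exp_of_nat_mult[of m "6 :: real"] by (simp add: mult.commute[of 6] flip: exp_add)
  finally show ?thesis .
qed

text \<open>Rounding is toward zero, so that no coordinate grows and the rounded point stays in the
  ball.\<close>

lemma real_truncate:
  obtains k :: int where "\<bar>real_of_int k\<bar> \<le> \<bar>a\<bar>" "\<bar>a - real_of_int k\<bar> \<le> 1"
proof (cases "a \<ge> 0")
  case True
  show ?thesis
    by (rule that[of "\<lfloor>a\<rfloor>"]) (use True zero_le_floor[of a] in \<open>linarith+\<close>)
next
  case False
  show ?thesis
    by (rule that[of "\<lceil>a\<rceil>"]) (use False ceiling_le_zero[of a] in \<open>linarith+\<close>)
qed

lemma int_grid_approx:
  assumes "m > 0" "enorm m y \<le> 2 * sqrt m"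
  obtains z where "z \<in> int_grid m" "enorm m (\<lambda>i. y i - real_of_int (z i)) \<le> sqrt m"
proof -
  have "\<exists>k::int. \<bar>real_of_int k\<bar> \<le> \<bar>y i\<bar> \<and> \<bar>y i - real_of_int k\<bar> \<le> 1" for i
    by (meson real_truncate)
  then obtain g :: "nat \<Rightarrow> int" where
    g: "\<And>i. \<bar>real_of_int (g i)\<bar> \<le> \<bar>y i\<bar>" "\<And>i. \<bar>y i - real_of_int (g i)\<bar> \<le> 1"
    by metis
  have "real_of_int (\<Sum>i<m. (g i)\<^sup>2) \<le> (\<Sum>i<m. (y i)\<^sup>2)"
    using g(1) by (auto intro!: sum_mono simp: abs_le_square_iff)
  also have "\<dots> \<le> (2 * sqrt m)\<^sup>2"
    unfolding enorm_square[symmetric] using assms(2) by (intro power_mono) auto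
  also have "\<dots> = real_of_int (4 * int m)"
    by (simp add: power_mult_distrib)
  finally have sq: "(\<Sum>i<m. (g i)\<^sup>2) \<le> 4 * int m"
    unfolding of_int_le_iff .
  have "g i \<in> {- (4 * int m)..4 * int m}" if "i < m" for i
  proof -
    \<comment> \<open>An integer is bounded in absolute value by its square, so the norm bound also
      gives membership in the box.\<close>
    have "\<bar>g i\<bar> * 1 \<le> \<bar>g i\<bar> * \<bar>g i\<bar>"
      by (cases "g i = 0") (simp, intro mult_left_mono, auto)
    then have "\<bar>g i\<bar> \<le> (g i)\<^sup>2"
      by (simp add: power2_eq_square flip: abs_mult)
    also have "\<dots> \<le> (\<Sum>i<m. (g i)\<^sup>2)"
      using that by (intro member_le_sum) auto
    finally show ?thesis using sq by (simp add: abs_le_iff)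
  qed
  then have "restrict g {..<m} \<in> int_grid m"
    using sq by (simp add: int_grid_def)
  moreover have "(\<Sum>i<m. (y i - real_of_int (g i))\<^sup>2) \<le> (\<Sum>i<m. 1)"
    using g(2) by (intro sum_mono) (simp add: abs_square_le_1)
  then have "enorm m (\<lambda>i. y i - real_of_int (restrict g {..<m} i)) \<le> sqrt m"
    by (simp add: enorm_def)
  ultimately show ?thesis ..
qed

text \<open>Rounding \<open>x\<close> to the grid at scale \<open>2 sqrt m / |x|\<close> leaves a remainder of half the norm, so
  any a priori bound \<open>F\<close> improves to \<open>R / (2 sqrt m) + F / 2\<close>; iterating removes \<open>F\<close>.\<close>

lemma sublinear_bound_from_int_grid:
  fixes f :: "(nat \<Rightarrow> real) \<Rightarrow> real"
  assumes add: "\<And>x y. f (\<lambda>i. x i + y i) \<le> f x + f y"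
    and scale: "\<And>c x. c \<ge> 0 \<Longrightarrow> f (\<lambda>i. c * x i) = c * f x"
    and bounded: "\<And>x. f x \<le> F * enorm m x"
    and grid: "\<And>z. z \<in> int_grid m \<Longrightarrow> f (\<lambda>i. real_of_int (z i)) \<le> R"
    and "m > 0" and "F \<ge> 0"
  shows "f x \<le> R / sqrt m * enorm m x"
proof -
  have improve: "f x \<le> (R / (2 * sqrt m) + H / 2) * enorm m x"
    if H: "\<And>x. f x \<le> H * enorm m x" and "H \<ge> 0" for x H
  proof (cases "enorm m x = 0")
    case True
    then show ?thesis using H[of x] by simp
  next
    case False
    then have pos: "enorm m x > 0"
      by (simp add: less_le)
    define c where "c = 2 * sqrt m / enorm m x"
    have c: "c > 0" using pos \<open>m > 0\<close> by (simp add: c_def)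
    have "enorm m (\<lambda>i. c * x i) \<le> 2 * sqrt m"
      using c pos by (subst enorm_scale) (simp add: c_def)
    then obtain z where z: "z \<in> int_grid m" "enorm m (\<lambda>i. c * x i - real_of_int (z i)) \<le> sqrt m"
      by (rule int_grid_approx[OF \<open>m > 0\<close>])
    have "c * f x = f (\<lambda>i. real_of_int (z i) + (c * x i - real_of_int (z i)))"
      using scale[of c x] c by simp
    also have "\<dots> \<le> R + H * sqrt m"
      using add[of "\<lambda>i. real_of_int (z i)" "\<lambda>i. c * x i - real_of_int (z i)"] grid[OF z(1)]
        H[of "\<lambda>i. c * x i - real_of_int (z i)"] mult_left_mono[OF z(2) \<open>H \<ge> 0\<close>]
      by linarith
    finally have "f x \<le> (R + H * sqrt m) / c"
      using c by (simp add: field_simps)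
    also have "\<dots> = (R / (2 * sqrt m) + H / 2) * enorm m x"
      using pos \<open>m > 0\<close> by (simp add: c_def field_simps)
    finally show ?thesis .
  qed
  \<comment> \<open>The origin of the grid is not the zero function, since it is
    \<open>undefined\<close> from \<open>m\<close> on. Therefore \<open>R \<ge> 0\<close> is derived
    by adding \<open>y\<close> and its negative, which has norm zero below \<open>m\<close>.\<close>
  define y :: "nat \<Rightarrow> real" where "y = (\<lambda>i. real_of_int (restrict (\<lambda>_. 0) {..<m} i))"
  have "restrict (\<lambda>_. 0) {..<m} \<in> int_grid m"
    by (auto simp: int_grid_def)
  then have "f y \<le> R"
    unfolding y_def by (rule grid)
  moreover have "f (\<lambda>i. - 1 * y i) \<le> 0"
    using bounded[of "\<lambda>i. - 1 * y i"] by (simp add: y_def enorm_def)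
  moreover have "f (\<lambda>i. y i + - 1 * y i) = 0"
    using scale[of 0 y] by simp
  ultimately have R: "R \<ge> 0"
    using add[of y "\<lambda>i. - 1 * y i"] by linarith
  \<comment> \<open>\<open>R / sqrt m\<close> is the fixed point of
    \<open>H \<mapsto> R / (2 * sqrt m) + H / 2\<close>, so each round halves only the excess
    \<open>F\<close>.\<close>
  have iter: "f x \<le> (R / sqrt m + F / 2 ^ n) * enorm m x" for n x
  proof (induction n arbitrary: x)
    case 0
    show ?case
      using bounded[of x] R by (auto intro!: order.trans[OF bounded] mult_right_mono)
  next
    case (Suc n)
    have "f x \<le> (R / (2 * sqrt m) + (R / sqrt m + F / 2 ^ n) / 2) * enorm m x"
      using R \<open>F \<ge> 0\<close> by (intro improve Suc) auto
    then show ?case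
      by (simp add: field_simps)
  qed
  have "(\<lambda>n. (R / sqrt m + F * (1 / 2) ^ n) * enorm m x) \<longlonglongrightarrow> (R / sqrt m + F * 0) * enorm m x"
    by (intro tendsto_intros LIMSEQ_power_zero) auto
  then have "f x \<le> (R / sqrt m + F * 0) * enorm m x"
    using iter by (intro LIMSEQ_le_const) (auto simp: power_divide)
  then show ?thesis by simp
qed

text \<open>The grid argument is applied twice: first to the linear form given by the image of a
  fixed grid point \<open>w\<close>, which bounds the norm of that image, then to the norm of the
  image as a function of \<open>v\<close>.\<close>

lemma operator_norm_from_int_grid:
  assumes grid: "\<And>z w. z \<in> int_grid t \<Longrightarrow> w \<in> int_grid d \<Longrightarrow>
      (\<Sum>i<t. real_of_int (z i) * (\<Sum>j<d. A i j * real_of_int (w j))) \<le> R"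
    and "t > 0" "d > 0" "R \<ge> 0"
  shows "enorm t (\<lambda>i. \<Sum>j<d. A i j * v j) \<le> R / sqrt (real t * real d) * enorm d v"
proof -
  have image: "enorm t (\<lambda>i. \<Sum>j<d. A i j * real_of_int (w j)) \<le> R / sqrt t" if w: "w \<in> int_grid d" for w
  proof -
    define y where "y = (\<lambda>i. \<Sum>j<d. A i j * real_of_int (w j))"
    have "(\<Sum>i<t. u i * y i) \<le> R / sqrt t * enorm t u" for u
    proof (rule sublinear_bound_from_int_grid[of "\<lambda>u. \<Sum>i<t. u i * y i" "enorm t y"])
      show "(\<Sum>i<t. x i * y i) \<le> enorm t y * enorm t x" for x
        using inner_le_enorm[where m = t and x = x and y = y] by (simp add: mult.commute)
      show "(\<Sum>i<t. real_of_int (z i) * y i) \<le> R" if "z \<in> int_grid t" for z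
        using grid[OF that w] by (simp add: y_def)
    qed (auto simp: algebra_simps sum.distrib sum_distrib_left \<open>t > 0\<close>)
    \<comment> \<open>Testing the linear form on \<open>y\<close> itself produces the squared norm
      of \<open>y\<close>.\<close>
    from this[of y] have "enorm t y * enorm t y \<le> R / sqrt t * enorm t y"
      using enorm_square[of t y] by (simp add: power2_eq_square)
    moreover have "0 \<le> R / sqrt t" using \<open>R \<ge> 0\<close> by simp
    ultimately have "enorm t y \<le> R / sqrt t"
      using enorm_nonneg[of t y] by (metis less_eq_real_def mult_le_cancel_right_pos)
    then show ?thesis by (simp add: y_def)
  qed
  have "enorm t (\<lambda>i. \<Sum>j<d. A i j * v j) \<le> R / sqrt t / sqrt d * enorm d v"
  \<comment> \<open>The sum of the row norms is only a crude a priori bound; it does not enter the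
    conclusion.\<close>
  proof (rule sublinear_bound_from_int_grid[of _ "\<Sum>i<t. enorm d (A i)"])
    show "enorm t (\<lambda>i. \<Sum>j<d. A i j * (x j + y j)) \<le>
        enorm t (\<lambda>i. \<Sum>j<d. A i j * x j) + enorm t (\<lambda>i. \<Sum>j<d. A i j * y j)" for x y
      using enorm_triangle[of t "\<lambda>i. \<Sum>j<d. A i j * x j" "\<lambda>i. \<Sum>j<d. A i j * y j"]
      by (simp add: distrib_left sum.distrib)
    show "enorm t (\<lambda>i. \<Sum>j<d. A i j * (c * x j)) = c * enorm t (\<lambda>i. \<Sum>j<d. A i j * x j)" if "c \<ge> 0" for c x
      using that enorm_scale[of t c "\<lambda>i. \<Sum>j<d. A i j * x j"]
      by (simp add: sum_distrib_left mult.left_commute)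
    show "enorm t (\<lambda>i. \<Sum>j<d. A i j * x j) \<le> (\<Sum>i<t. enorm d (A i)) * enorm d x" for x
    proof -
      have "\<bar>\<Sum>j<d. A i j * x j\<bar> \<le> enorm d (A i) * enorm d x" for i
        using inner_le_enorm[where m = d and x = "A i" and y = x]
          inner_le_enorm[where m = d and x = "A i" and y = "\<lambda>j. - 1 * x j"] enorm_scale[of d "-1" x]
        by (simp add: sum_negf)
      then have "(\<Sum>i<t. \<bar>\<Sum>j<d. A i j * x j\<bar>) \<le> (\<Sum>i<t. enorm d (A i) * enorm d x)"
        by (intro sum_mono)
      moreover have "enorm t (\<lambda>i. \<Sum>j<d. A i j * x j) \<le> (\<Sum>i<t. \<bar>\<Sum>j<d. A i j * x j\<bar>)"
        unfolding enorm_eq_L2_set by (rule L2_set_le_sum_abs)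
      ultimately show ?thesis by (simp add: sum_distrib_right)
    qed
  qed (auto intro: image sum_nonneg \<open>d > 0\<close>)
  then show ?thesis by (simp add: real_sqrt_mult)
qed

section \<open>Expansion and contraction with high probability\<close>

lemma sign_matrix_operator_norm:
  assumes "t > 0" "d > 0"
  shows "measure_pmf.prob (sign_matrix t d)
      {A. \<exists>v. enorm t (\<lambda>i. \<Sum>j<d. A i j * v j) > 16 * sqrt (real d + real t) * enorm d v}
    \<le> exp (- 2 * (real d + real t))"
proof -
  define B where "B = (\<lambda>z w A. \<Sum>i<t. real_of_int (z i) * (\<Sum>j<d. A i j * real_of_int (w j)))"
  \<comment> \<open>\<open>R\<close> is what the grid lemma needs for the norm bound
    \<open>16 * sqrt (d + t)\<close>, and \<open>Q\<close> is the product of the squared radii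
    \<open>4 * t\<close> and \<open>4 * d\<close>. The resulting tail exponent
    \<open>8 * (d + t)\<close> beats the number of grid pairs, at most
    \<open>exp (6 * (d + t))\<close>.\<close>
  define R where "R = 16 * sqrt (real d + real t) * sqrt (real t * real d)"
  define Q where "Q = 16 * (real t * real d)"
  let ?G = "int_grid t \<times> int_grid d"
  have R: "R \<ge> 0" and Q: "Q > 0" using assms by (auto simp: R_def Q_def)
  have R_square: "- R\<^sup>2 / (2 * Q) = - 8 * (real d + real t)"
    using assms by (simp add: R_def Q_def power_mult_distrib field_simps)
  have "measure_pmf.prob (sign_matrix t d)
      {A. \<exists>v. enorm t (\<lambda>i. \<Sum>j<d. A i j * v j) > 16 * sqrt (real d + real t) * enorm d v}
    \<le> measure_pmf.prob (sign_matrix t d) (\<Union>(z, w)\<in>?G. {A. B z w A > R})"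
  proof (rule measure_pmf.finite_measure_mono, rule subsetI)
    fix A assume "A \<in> {A. \<exists>v. enorm t (\<lambda>i. \<Sum>j<d. A i j * v j) > 16 * sqrt (real d + real t) * enorm d v}"
    then obtain v where v: "enorm t (\<lambda>i. \<Sum>j<d. A i j * v j) > 16 * sqrt (real d + real t) * enorm d v"
      by blast
    have "R / sqrt (real t * real d) = 16 * sqrt (real d + real t)"
      using assms by (simp add: R_def)
    then have "\<not> (\<forall>z\<in>int_grid t. \<forall>w\<in>int_grid d. B z w A \<le> R)"
      using operator_norm_from_int_grid[of t d A R v] assms R v unfolding B_def by fastforce
    then show "A \<in> (\<Union>(z, w)\<in>?G. {A. B z w A > R})"
      by (auto simp: not_le)
  qed auto
  also have "\<dots> \<le> (\<Sum>(z, w)\<in>?G. measure_pmf.prob (sign_matrix t d) {A. B z w A > R})"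
    using measure_pmf.finite_measure_subadditive_finite[of ?G "\<lambda>(z, w). {A. B z w A > R}" "sign_matrix t d"]
    by (simp add: finite_int_grid case_prod_beta')
  also have "\<dots> \<le> (\<Sum>(z, w)\<in>?G. exp (- 8 * (real d + real t)))"
  proof (intro sum_mono, clarify)
    fix z w assume z: "z \<in> int_grid t" and w: "w \<in> int_grid d"
    have grid: "(\<Sum>i<m. (real_of_int (u i))\<^sup>2) \<le> 4 * real m" if "u \<in> int_grid m" for u m
    proof -
      have "real_of_int (\<Sum>i<m. (u i)\<^sup>2) \<le> real_of_int (4 * int m)"
        using that unfolding of_int_le_iff int_grid_def by simp
      then show ?thesis by simp
    qed
    have "(\<Sum>i<t. (real_of_int (z i))\<^sup>2) * (\<Sum>j<d. (real_of_int (w j))\<^sup>2) \<le> (4 * real t) * (4 * real d)"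
      by (intro mult_mono grid z w) (auto intro: sum_nonneg)
    then show "measure_pmf.prob (sign_matrix t d) {A. B z w A > R} \<le> exp (- 8 * (real d + real t))"
      unfolding B_def R_square[symmetric] using Q R
      by (intro sign_matrix_upper_tail) (auto simp: Q_def)
  qed
  also have "\<dots> = real (card (int_grid t)) * real (card (int_grid d)) * exp (- 8 * (real d + real t))"
    by (simp add: card_cartesian_product)
  also have "\<dots> \<le> exp (6 * real t) * exp (6 * real d) * exp (- 8 * (real d + real t))"
    by (intro mult_mono card_int_grid) auto
  also have "\<dots> = exp (- 2 * (real d + real t))"
    by (simp add: algebra_simps flip: exp_add)
  finally show ?thesis .
qed

text \<open>A union bound of the lower tail over all ordered pairs; squaring
  \<open>sqrt t / 2\<close> gives the threshold factor \<open>t / 4\<close>.\<close>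

lemma sign_matrix_noncontracting:
  assumes "finite U"
  shows "measure_pmf.prob (sign_matrix t d)
      {A. \<exists>x\<in>U. \<exists>y\<in>U. enorm t (\<lambda>i. \<Sum>j<d. A i j * (x j - y j)) < sqrt (real t) / 2 * edist d x y}
    \<le> (real (card U))\<^sup>2 * exp (- real t / 12)"
proof -
  define B where "B = (\<lambda>v. {A. (\<Sum>i<t. (\<Sum>j<d. A i j * v j)\<^sup>2) < real t * (\<Sum>j<d. (v j)\<^sup>2) / 4})"
  have "A \<in> B (\<lambda>j. x j - y j)"
    if "enorm t (\<lambda>i. \<Sum>j<d. A i j * (x j - y j)) < sqrt (real t) / 2 * edist d x y" for A x y
  proof -
    have "(enorm t (\<lambda>i. \<Sum>j<d. A i j * (x j - y j)))\<^sup>2 < (sqrt (real t) / 2 * edist d x y)\<^sup>2"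
      using that by (intro power_strict_mono) auto
    then show ?thesis
      by (simp add: B_def edist_def enorm_square power_mult_distrib power_divide)
  qed
  then have "measure_pmf.prob (sign_matrix t d)
      {A. \<exists>x\<in>U. \<exists>y\<in>U. enorm t (\<lambda>i. \<Sum>j<d. A i j * (x j - y j)) < sqrt (real t) / 2 * edist d x y}
    \<le> measure_pmf.prob (sign_matrix t d) (\<Union>(x, y)\<in>U \<times> U. B (\<lambda>j. x j - y j))"
    by (intro measure_pmf.finite_measure_mono) auto
  also have "\<dots> \<le> (\<Sum>(x, y)\<in>U \<times> U. measure_pmf.prob (sign_matrix t d) (B (\<lambda>j. x j - y j)))"
    using measure_pmf.finite_measure_subadditive_finite[of "U \<times> U" "\<lambda>(x, y). B (\<lambda>j. x j - y j)" "sign_matrix t d"]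
    by (simp add: assms case_prod_beta')
  also have "\<dots> \<le> (\<Sum>(x, y)\<in>U \<times> U. exp (- real t / 12))"
    unfolding B_def case_prod_unfold by (intro sum_mono sign_matrix_lower_tail)
  also have "\<dots> = (real (card U))\<^sup>2 * exp (- real t / 12)"
    by (simp add: card_cartesian_product power2_eq_square)
  finally show ?thesis .
qed

subsection \<open>Separated sets and the k-center value\<close>

lemma edist_nonneg [simp]: "0 \<le> edist m x y"
  by (simp add: edist_def)

lemma edist_self [simp]: "edist m x x = 0"
  by (simp add: edist_def enorm_def)

lemma edist_commute: "edist m x y = edist m y x"
  by (simp add: edist_def enorm_def power2_commute)

lemma edist_triangle: "edist m x z \<le> edist m x y + edist m y z"
  using enorm_triangle[of m "\<lambda>i. x i - y i" "\<lambda>i. y i - z i"] by (simp add: edist_def)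

lemma infinite_Rn:
  assumes "m > 0"
  shows "infinite (Rn m)"
proof -
  have "inj (\<lambda>(n::nat) i. if i = 0 then real n else 0)"
    by (rule injI) (metis of_nat_eq_iff)
  moreover have "range (\<lambda>(n::nat) i. if i = 0 then real n else 0) \<subseteq> Rn m"
    using assms by (auto simp: Rn_def)
  ultimately show ?thesis
    using infinite_iff_countable_subset by blast
qed

lemma kcost_le_iff:
  assumes "finite X" "X \<noteq> {}" "finite C" "C \<noteq> {}"
  shows "kcost m X C \<le> b \<longleftrightarrow> (\<forall>x\<in>X. \<exists>c\<in>C. edist m x c \<le> b)"
  using assms by (simp add: kcost_def dist_to_def Min_le_iff)

lemma kcost_less_iff:
  assumes "finite X" "X \<noteq> {}" "finite C" "C \<noteq> {}"
  shows "kcost m X C < b \<longleftrightarrow> (\<forall>x\<in>X. \<exists>c\<in>C. edist m x c < b)"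
  using assms by (simp add: kcost_def dist_to_def Min_less_iff)

lemma kcost_attained:
  assumes "finite X" "x \<in> X" "finite C" "C \<noteq> {}"
  shows "\<exists>c\<in>C. edist m x c \<le> kcost m X C"
  using assms kcost_le_iff[of X C m "kcost m X C"] by blast

lemma kcost_nonneg:
  assumes "finite X" "X \<noteq> {}" "finite C" "C \<noteq> {}"
  shows "0 \<le> kcost m X C"
  using assms kcost_attained edist_nonneg by (metis all_not_in_conv order.trans)

text \<open>The optimum ranges over sets of exactly \<open>k\<close> centers, so smaller covers are
  padded with points of the infinite set \<open>Rn m\<close>.\<close>

lemma extend_centers:
  assumes "m > 0" "T \<subseteq> Rn m" "finite T" "card T \<le> k"
  obtains C where "T \<subseteq> C" "C \<subseteq> Rn m" "card C = k"
proof -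
  have "infinite (Rn m - T)"
    using infinite_Rn[OF assms(1)] assms(3) by simp
  then obtain D where D: "finite D" "card D = k - card T" "D \<subseteq> Rn m - T"
    by (meson infinite_arbitrarily_large)
  then have "card (T \<union> D) = k"
    using assms by (subst card_Un_disjoint) auto
  then show ?thesis
    using D assms(2) by (intro that[of "T \<union> D"]) auto
qed

context
  fixes m k :: nat and X :: "(nat \<Rightarrow> real) set"
  assumes m: "m > 0" and k: "k \<ge> 1" and X: "finite X" "X \<noteq> {}"
begin

lemma opt_vanilla_greatest:
  assumes "\<And>C. C \<subseteq> Rn m \<Longrightarrow> card C = k \<Longrightarrow> r \<le> kcost m X C"
  shows "r \<le> opt_vanilla k m X"
proof -
  obtain C where "C \<subseteq> Rn m" "card C = k"
    by (rule extend_centers[of m "{}" k]) (use m in auto)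
  then show ?thesis
    unfolding opt_vanilla_def using assms by (intro cInf_greatest) auto
qed

text \<open>Infinite sets have cardinality 0 in HOL, so \<open>k \<ge> 1\<close> excludes both them
  and the empty set.\<close>

lemma centers_finite_nonempty: "finite C" "C \<noteq> {}" if "card C = k" for C :: "(nat \<Rightarrow> real) set"
  using that k by (auto intro: card_ge_0_finite)

lemma opt_vanilla_le_kcost:
  assumes "C \<subseteq> Rn m" "card C = k"
  shows "opt_vanilla k m X \<le> kcost m X C"
  unfolding opt_vanilla_def
proof (rule cInf_lower)
  show "bdd_below {kcost m X C | C. C \<subseteq> Rn m \<and> card C = k}"
    using X centers_finite_nonempty kcost_nonneg by (intro bdd_belowI[of _ 0]) blast
qed (use assms in auto)

lemma opt_vanilla_nonneg: "0 \<le> opt_vanilla k m X"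
  using X centers_finite_nonempty kcost_nonneg by (intro opt_vanilla_greatest) auto

lemma opt_vanilla_le_cover:
  assumes "T \<subseteq> Rn m" "finite T" "card T \<le> k" "\<And>x. x \<in> X \<Longrightarrow> \<exists>c\<in>T. edist m x c \<le> b"
  shows "opt_vanilla k m X \<le> b"
proof -
  obtain C where C: "T \<subseteq> C" "C \<subseteq> Rn m" "card C = k"
    using extend_centers[OF m assms(1-3)] .
  have "kcost m X C \<le> b"
    using assms(4) C(1) X centers_finite_nonempty[OF C(3)] by (subst kcost_le_iff) blast+
  then show ?thesis
    using opt_vanilla_le_kcost[OF C(2,3)] by linarith
qed

text \<open>Strictness survives because the maximum is over a finite set. This contradicts
  optimality when a set of at most \<open>k\<close> points covers within less than the
  optimum.\<close>

lemma opt_vanilla_less_cover: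
  assumes "T \<subseteq> Rn m" "finite T" "card T \<le> k" "\<And>x. x \<in> X \<Longrightarrow> \<exists>c\<in>T. edist m x c < b"
  shows "opt_vanilla k m X < b"
proof -
  obtain C where C: "T \<subseteq> C" "C \<subseteq> Rn m" "card C = k"
    using extend_centers[OF m assms(1-3)] .
  have "kcost m X C < b"
    using assms(4) C(1) X centers_finite_nonempty[OF C(3)] by (subst kcost_less_iff) blast+
  then show ?thesis
    using opt_vanilla_le_kcost[OF C(2,3)] by linarith
qed

text \<open>Pigeonhole: two points of \<open>S\<close> are served by the same center, and the
  triangle inequality bounds their distance by twice the cost.\<close>

lemma opt_vanilla_ge_packing:
  assumes "S \<subseteq> X" "k < card S" "pairwise (\<lambda>x y. 2 * r \<le> edist m x y) S"
  shows "r \<le> opt_vanilla k m X"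
proof (rule opt_vanilla_greatest)
  fix C assume C: "C \<subseteq> Rn m" "card C = k"
  have "\<forall>x\<in>S. \<exists>c\<in>C. edist m x c \<le> kcost m X C"
    using kcost_attained[OF X(1) _ centers_finite_nonempty[OF C(2)]] assms(1) by blast
  then obtain g where g: "\<And>x. x \<in> S \<Longrightarrow> g x \<in> C" "\<And>x. x \<in> S \<Longrightarrow> edist m x (g x) \<le> kcost m X C"
    by metis
  have "card (g ` S) \<le> k"
    using C(2) card_mono[OF centers_finite_nonempty(1)[OF C(2)], of "g ` S"] g(1) by auto
  then have "\<not> inj_on g S"
    using assms(2) by (auto dest: card_image)
  then obtain x y where xy: "x \<in> S" "y \<in> S" "x \<noteq> y" "g x = g y"
    by (auto simp: inj_on_def)
  have "2 * r \<le> edist m x y"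
    using assms(3) xy by (auto simp: pairwise_def)
  also have "\<dots> \<le> edist m x (g x) + edist m y (g y)"
    using edist_triangle[of m x y "g x"] xy(4) by (simp add: edist_commute)
  also have "\<dots> \<le> 2 * kcost m X C"
    using g(2)[OF xy(1)] g(2)[OF xy(2)] by linarith
  finally show "r \<le> kcost m X C" by simp
qed

end

section \<open>Packings and covers at the scale of the optimum\<close>

lemma maximal_pairwise_subset:
  assumes "finite P" "symp R"
  obtains S where "S \<subseteq> P" "pairwise R S" "\<And>p. p \<in> P \<Longrightarrow> p \<in> S \<or> (\<exists>s\<in>S. \<not> R p s)"
proof -
  let ?F = "{S. S \<subseteq> P \<and> pairwise R S}"
  have "finite ?F" "?F \<noteq> {}"
    using assms(1) by (auto intro: exI[of _ "{}"])
  then obtain S where S: "S \<in> ?F" "\<And>T. T \<in> ?F \<Longrightarrow> S \<subseteq> T \<Longrightarrow> S = T"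
    using finite_has_maximal[of ?F] by (metis (lifting))
  have "\<exists>s\<in>S. \<not> R p s" if "p \<in> P" "p \<notin> S" for p
  proof (rule ccontr)
    assume "\<not> (\<exists>s\<in>S. \<not> R p s)"
    then have "insert p S \<in> ?F"
      using S(1) that assms(2) by (auto simp: pairwise_insert sympD)
    then show False using S(2)[of "insert p S"] that by auto
  qed
  then show ?thesis using S(1) that by blast
qed

text \<open>Maximal separated sets are also covers. Separation above \<open>2 * r\<close> forces at
  most \<open>k\<close> points by the packing bound; separation at least \<open>r > 0\<close> forces
  more than \<open>k\<close>, since fewer would cover strictly within \<open>r\<close>.\<close>

lemma separated_witnesses:
  assumes "d > 0" "k \<ge> 1" "finite P" "P \<noteq> {}" "P \<subseteq> Rn d"
  defines "r \<equiv> opt_vanilla k d P"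
  obtains T S where "T \<subseteq> P" "card T \<le> k" "\<And>p. p \<in> P \<Longrightarrow> \<exists>c\<in>T. edist d p c \<le> 2 * r"
    "S \<subseteq> P" "card S \<le> Suc k" "pairwise (\<lambda>x y. r \<le> edist d x y) S" "r = 0 \<or> card S = Suc k"
proof -
  note ctx = assms(1-4)
  have r: "0 \<le> r" unfolding r_def by (rule opt_vanilla_nonneg[OF ctx])
  obtain T where T: "T \<subseteq> P" "pairwise (\<lambda>x y. 2 * r < edist d x y) T"
    "\<And>p. p \<in> P \<Longrightarrow> p \<in> T \<or> (\<exists>c\<in>T. \<not> 2 * r < edist d p c)"
    by (rule maximal_pairwise_subset[OF assms(3), of "\<lambda>x y. 2 * r < edist d x y"])
      (auto simp: symp_def edist_commute)
  have cover: "\<exists>c\<in>T. edist d p c \<le> 2 * r" if "p \<in> P" for p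
    using T(3)[OF that] r by (auto simp: not_less intro: bexI[of _ p])
  have card_T: "card T \<le> k"
  proof (rule ccontr)
    assume *: "\<not> card T \<le> k"
    have fin: "finite T" using T(1) assms(3) finite_subset by blast
    \<comment> \<open>Finitely many distances above \<open>2 * r\<close> leave a gap: their minimum
      also exceeds \<open>2 * r\<close>, so the packing bound at half of it contradicts the value
      \<open>r\<close>.\<close>
    define D where "D = (\<lambda>(x, y). edist d x y) ` {(x, y) \<in> T \<times> T. x \<noteq> y}"
    have "finite {(x, y) \<in> T \<times> T. x \<noteq> y}"
      by (rule finite_subset[of _ "T \<times> T"]) (use fin in auto)
    then have D: "finite D" by (simp add: D_def)
    have "\<not> card T \<le> Suc 0" using * assms(2) by linarith
    then obtain x y where "x \<in> T" "y \<in> T" "x \<noteq> y"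
      using fin by (auto simp: card_le_Suc0_iff_eq)
    then have "D \<noteq> {}" by (auto simp: D_def)
    have "Min D / 2 \<le> r"
      unfolding r_def
    proof (rule opt_vanilla_ge_packing[OF ctx T(1)])
      show "pairwise (\<lambda>x y. 2 * (Min D / 2) \<le> edist d x y) T"
        using D by (auto simp: pairwise_def D_def intro!: Min_le)
    qed (use * in auto)
    moreover have "2 * r < Min D"
      using D \<open>D \<noteq> {}\<close> T(2) by (auto simp: D_def pairwise_def)
    ultimately show False by simp
  qed
  obtain S where S: "S \<subseteq> P" "pairwise (\<lambda>x y. r \<le> edist d x y) S"
    "\<And>p. p \<in> P \<Longrightarrow> p \<in> S \<or> (\<exists>c\<in>S. \<not> r \<le> edist d p c)"
    by (rule maximal_pairwise_subset[OF assms(3), of "\<lambda>x y. r \<le> edist d x y"])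
      (auto simp: symp_def edist_commute)
  show ?thesis
  proof (cases "r = 0")
    case True
    then show ?thesis using that[OF T(1) card_T cover, of "{}"] by simp
  next
    case False
    have "k < card S"
    proof (rule ccontr)
      assume "\<not> k < card S"
      moreover have "\<exists>c\<in>S. edist d p c < r" if "p \<in> P" for p
        using S(3)[OF that] r False by (auto simp: not_le intro: bexI[of _ p])
      ultimately have "opt_vanilla k d P < r"
        using S(1) assms(3,5) unfolding r_def
        by (intro opt_vanilla_less_cover[OF ctx, of S]) (auto intro: finite_subset)
      then show False by (simp add: r_def)
    qed
    \<comment> \<open>Exactly \<open>k + 1\<close> points are kept, since the later union bound is
      paid on their number.\<close>
    then obtain S' where "S' \<subseteq> S" "card S' = Suc k"
      by (meson Suc_leI obtain_subset_with_card_n)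
    then show ?thesis
      using that[OF T(1) card_T cover, of S'] S by (auto intro: pairwise_subset)
  qed
qed

text \<open>The deterministic half: the Lipschitz bound is used on all of \<open>P\<close>,
  expansion only on \<open>T \<union> S\<close>.\<close>

lemma kcenter_embedding:
  assumes "d > 0" "t > 0" "k \<ge> 1" and P: "finite P" "P \<noteq> {}" "P \<subseteq> Rn d"
    and range: "\<And>x. L x \<in> Rn t"
    and "K \<ge> 0" and lip: "\<And>x y. x \<in> P \<Longrightarrow> y \<in> P \<Longrightarrow> edist t (L x) (L y) \<le> K * edist d x y"
    and T: "T \<subseteq> P" "card T \<le> k" "\<And>p. p \<in> P \<Longrightarrow> \<exists>c\<in>T. edist d p c \<le> 2 * opt_vanilla k d P"
    and S: "S \<subseteq> P" "pairwise (\<lambda>x y. opt_vanilla k d P \<le> edist d x y) S"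
      "opt_vanilla k d P = 0 \<or> card S = Suc k"
    and expand: "\<And>x y. x \<in> T \<union> S \<Longrightarrow> y \<in> T \<union> S \<Longrightarrow> 2 * edist d x y \<le> edist t (L x) (L y)"
  shows "is_estimation (opt_vanilla k d P) (opt_vanilla k t (L ` P)) (2 * K)"
    and "\<beta> \<ge> 0 \<Longrightarrow> C \<subseteq> P \<Longrightarrow> card C = k \<Longrightarrow> approx_sol k t (L ` P) (L ` C) \<beta>
      \<Longrightarrow> approx_sol k d P C (4 + (\<beta> + 2) * K)"
proof -
  define r where "r = opt_vanilla k d P"
  have LP: "finite (L ` P)" "L ` P \<noteq> {}"
    using P by auto
  have r: "0 \<le> r" unfolding r_def using assms by (intro opt_vanilla_nonneg) auto
  have upper: "opt_vanilla k t (L ` P) \<le> 2 * K * r"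
  proof (rule opt_vanilla_le_cover[OF \<open>t > 0\<close> \<open>k \<ge> 1\<close> LP, of "L ` T"])
    have "finite T" using T(1) P(1) finite_subset by blast
    then show "finite (L ` T)" "card (L ` T) \<le> k"
      using T(2) card_image_le[of T L] by auto
    show "L ` T \<subseteq> Rn t" using range by auto
    show "\<exists>c\<in>L ` T. edist t x c \<le> 2 * K * r" if x: "x \<in> L ` P" for x
    proof -
      obtain p where p: "p \<in> P" "x = L p" using x by blast
      obtain c where c: "c \<in> T" "edist d p c \<le> 2 * r" using T(3)[OF p(1)] by (auto simp: r_def)
      have "edist t x (L c) \<le> K * (2 * r)"
        using lip[of p c] p c T(1) mult_left_mono[OF c(2) \<open>K \<ge> 0\<close>] by (auto intro: order.trans)
      then show ?thesis using c(1) by (auto simp: mult_ac)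
    qed
  qed
  have lower: "r \<le> opt_vanilla k t (L ` P)"
  proof (cases "r = 0")
    case True
    then show ?thesis using opt_vanilla_nonneg[OF \<open>t > 0\<close> \<open>k \<ge> 1\<close> LP] by simp
  next
    case False
    \<comment> \<open>Points of \<open>S\<close> are only \<open>r\<close> apart, while the packing
      bound loses a factor 2; the expansion factor 2 makes up for it.\<close>
    have far: "2 * r \<le> edist t (L x) (L y)" if "x \<in> S" "y \<in> S" "x \<noteq> y" for x y
      using expand[of x y] that S(2) r by (force simp: pairwise_def r_def)
    have "inj_on L S"
    proof (rule inj_onI, rule ccontr)
      fix x y assume "x \<in> S" "y \<in> S" "L x = L y" "x \<noteq> y"
      then show False using far[of x y] r False by simp
    qed
    then have "card (L ` S) = Suc k"
      using S(3) False by (simp add: card_image r_def)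
    then show ?thesis
      using S(1) far by (intro opt_vanilla_ge_packing[OF \<open>t > 0\<close> \<open>k \<ge> 1\<close> LP, of "L ` S"])
        (auto simp: pairwise_def)
  qed
  show "is_estimation (opt_vanilla k d P) (opt_vanilla k t (L ` P)) (2 * K)"
    using upper lower by (simp add: is_estimation_def r_def)
  assume \<beta>: "\<beta> \<ge> 0" and C: "C \<subseteq> P" "card C = k" "approx_sol k t (L ` P) (L ` C) \<beta>"
  have finC: "finite C" "C \<noteq> {}"
    using centers_finite_nonempty[OF \<open>t > 0\<close> \<open>k \<ge> 1\<close> LP C(2)] by auto
  have "kcost d P C \<le> (4 + (\<beta> + 2) * K) * r"
  proof (subst kcost_le_iff[OF P(1,2) finC], intro ballI)
    fix p assume p: "p \<in> P"
    obtain c where c: "c \<in> C" "edist t (L p) (L c) \<le> kcost t (L ` P) (L ` C)"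
      using kcost_attained[OF LP(1), of "L p" "L ` C"] p finC by blast
    have "kcost t (L ` P) (L ` C) \<le> \<beta> * (2 * K * r)"
      using C(3) mult_left_mono[OF upper \<beta>] by (auto simp: approx_sol_def)
    then have close: "edist t (L p) (L c) \<le> \<beta> * (2 * K * r)" using c(2) by linarith
    have cP: "c \<in> P" using c(1) C(1) by blast
    obtain q where q: "q \<in> T" "edist d p q \<le> 2 * r" using T(3)[OF p] by (auto simp: r_def)
    obtain e where e: "e \<in> T" "edist d c e \<le> 2 * r" using T(3)[OF cP] by (auto simp: r_def)
    have "edist t (L p) (L q) \<le> K * (2 * r)" "edist t (L c) (L e) \<le> K * (2 * r)"
      using lip[of p q] lip[of c e] p cP q e T(1) mult_left_mono[OF q(2) \<open>K \<ge> 0\<close>]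
        mult_left_mono[OF e(2) \<open>K \<ge> 0\<close>] by (auto intro: order.trans)
    \<comment> \<open>The path from \<open>L q\<close> to \<open>L e\<close> runs through
      \<open>L p\<close> and \<open>L c\<close>: the outer legs cost \<open>2 * K * r\<close> each,
      the middle one \<open>2 * \<beta> * K * r\<close>.\<close>
    moreover have "edist t (L q) (L e) \<le> edist t (L p) (L q) + edist t (L p) (L c) + edist t (L c) (L e)"
      using edist_triangle[of t "L q" "L e" "L p"] edist_triangle[of t "L p" "L e" "L c"]
      by (simp add: edist_commute)
    moreover have "2 * edist d q e \<le> edist t (L q) (L e)"
      using expand q e by auto
    ultimately have "2 * edist d q e \<le> 2 * ((\<beta> + 2) * K * r)"
      using close by (simp add: algebra_simps)
    moreover have "edist d p c \<le> edist d p q + edist d q e + edist d c e"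
      using edist_triangle[of d p c q] edist_triangle[of d q c e] by (simp add: edist_commute)
    ultimately have "edist d p c \<le> (4 + (\<beta> + 2) * K) * r"
      using q(2) e(2) by (simp add: algebra_simps)
    then show "\<exists>c\<in>C. edist d p c \<le> (4 + (\<beta> + 2) * K) * r" using c(1) by blast
  qed
  then show "approx_sol k d P C (4 + (\<beta> + 2) * K)"
    using C by (simp add: approx_sol_def r_def)
qed

section \<open>Assembling the random map\<close>

lemma edist_apply_lin_scaled:
  assumes "c \<ge> 0"
  shows "edist t (apply_lin t d (\<lambda>i j. c * A i j) x) (apply_lin t d (\<lambda>i j. c * A i j) y)
    = c * enorm t (\<lambda>i. \<Sum>j<d. A i j * (x j - y j))"
proof -
  have "edist t (apply_lin t d (\<lambda>i j. c * A i j) x) (apply_lin t d (\<lambda>i j. c * A i j) y)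
      = enorm t (\<lambda>i. c * (\<Sum>j<d. A i j * (x j - y j)))"
    by (simp add: edist_def enorm_def apply_lin_def sum_distrib_left right_diff_distrib sum_subtractf mult.assoc)
  then show ?thesis
    using assms by (simp add: enorm_scale)
qed

lemma approx_sol_mono:
  assumes "approx_sol k m X C \<gamma>" "\<gamma> \<le> \<gamma>'" "0 \<le> opt_vanilla k m X"
  shows "approx_sol k m X C \<gamma>'"
  using assms mult_right_mono[OF assms(2,3)] by (auto simp: approx_sol_def)

lemma is_estimation_mono:
  assumes "is_estimation x y \<gamma>" "\<gamma> \<le> \<gamma>'" "0 \<le> x"
  shows "is_estimation x y \<gamma>'"
  using assms mult_right_mono[OF assms(2,3)] by (auto simp: is_estimation_def)

theorem theorem2p1:
  fixes \<beta> :: real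
  assumes "\<beta> \<ge> 1"
  shows "\<exists>c>0. \<forall>(d::nat) (\<alpha>::real) (k::nat) (n::nat).
           d > 1 \<and> \<alpha> > 1 \<and> 1 \<le> k \<and> k \<le> n \<longrightarrow>
           (\<exists>(t::nat) (M::(nat \<Rightarrow> nat \<Rightarrow> real) measure).
              real t \<le> c * (1 + ln (real k) + real d / \<alpha>\<^sup>2) \<and>
              prob_space M \<and>
              (\<forall>P. P \<subseteq> Rn d \<and> finite P \<and> card P = n \<longrightarrow>
                 measure M {A \<in> space M.
                    is_estimation (opt_vanilla k d P)
                                  (opt_vanilla k t (apply_lin t d A ` P)) (c * \<alpha>) \<and>
                    (\<forall>C. C \<subseteq> P \<and> card C = k \<and>
                          approx_sol k t (apply_lin t d A ` P) (apply_lin t d A ` C) \<beta>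
                          \<longrightarrow> approx_sol k d P C (c * \<alpha>))} \<ge> 2/3))"
\<comment> \<open>One constant serves three bounds: \<open>61\<close> for the dimension,
  \<open>2 * 128\<close> for the estimation, and \<open>4 + (\<beta> + 2) * 128\<close> for the
  solutions, where \<open>4 \<le> 4 * \<alpha>\<close>.\<close>
proof (intro exI[of _ "260 + 128 * \<beta>"] conjI allI impI)
  show "260 + 128 * \<beta> > 0" using assms by simp
  fix d k n :: nat and \<alpha> :: real
  assume "d > 1 \<and> \<alpha> > 1 \<and> 1 \<le> k \<and> k \<le> n"
  then have d: "d > 1" and \<alpha>: "\<alpha> > 1" and k: "1 \<le> k" and kn: "k \<le> n" by auto
  define c where "c = 260 + 128 * \<beta>"
  \<comment> \<open>The factor 60 gives \<open>t / 12 \<ge> 5 + 2 * ln k\<close>, which pays for the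
    order of \<open>k^2\<close> pairs in the union bound; the second summand keeps
    \<open>d / t\<close> below \<open>\<alpha>^2\<close>.\<close>
  define T where "T = 60 * (1 + ln (real k)) + real d / \<alpha>\<^sup>2"
  define t where "t = nat \<lceil>T\<rceil>"
  \<comment> \<open>This scaling turns the lower bound \<open>sqrt t / 2\<close> into the expansion
    factor 2.\<close>
  define \<sigma> where "\<sigma> = 4 / sqrt (real t)"
  define M where "M = map_pmf (\<lambda>A i j. \<sigma> * A i j) (sign_matrix t d)"
  have ln_k: "ln (real k) \<ge> 0" using k by simp
  have d_\<alpha>: "real d / \<alpha>\<^sup>2 \<ge> 0" by simp
  have T: "T \<ge> 60" using ln_k d_\<alpha> by (simp add: T_def)
  have t: "real t \<ge> T" "real t \<le> T + 1"
    using T unfolding t_def by linarith+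
  have "60 * (1 + ln (real k)) \<le> T" by (simp add: T_def)
  then have t_ge: "60 * (1 + ln (real k)) \<le> real t" using t(1) by linarith
  have t_pos: "t > 0" using t T by simp
  have "x \<le> 61 * (1 + l + q)" if "x \<le> 60 * (1 + l) + q + 1" "0 \<le> l" "0 \<le> q" for x l q :: real
    using that by (simp add: algebra_simps)
  then have "real t \<le> 61 * (1 + ln (real k) + real d / \<alpha>\<^sup>2)"
    using t(2) ln_k d_\<alpha> unfolding T_def by blast
  also have "\<dots> \<le> c * (1 + ln (real k) + real d / \<alpha>\<^sup>2)"
    using assms ln_k d_\<alpha> by (intro mult_right_mono) (auto simp: c_def)
  finally have t_bound: "real t \<le> c * (1 + ln (real k) + real d / \<alpha>\<^sup>2)" .

  have \<sigma>: "\<sigma> > 0" using t_pos by (simp add: \<sigma>_def)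
  have "real d / \<alpha>\<^sup>2 \<le> real t" using t(1) ln_k by (simp add: T_def)
  then have "real d / real t \<le> \<alpha>\<^sup>2"
    using t_pos \<alpha> by (simp add: field_simps)
  moreover have "1 \<le> \<alpha>\<^sup>2" using \<alpha> by (simp add: power2_eq_square less_imp_le mult_ge1_I)
  \<comment> \<open>The ratio is at most \<open>\<alpha>^2 + 1\<close>; with
    \<open>16 * \<sigma> = 64 / sqrt t\<close> this yields the Lipschitz constant
    \<open>128 * \<alpha>\<close>.\<close>
  ultimately have "(real d + real t) / real t \<le> (2 * \<alpha>)\<^sup>2"
    using t_pos by (simp add: add_divide_distrib power_mult_distrib)
  then have "sqrt ((real d + real t) / real t) \<le> 2 * \<alpha>"
    using \<alpha> by (intro real_le_lsqrt) auto
  then have expansion: "\<sigma> * (16 * sqrt (real d + real t)) \<le> 128 * \<alpha>"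
    by (simp add: \<sigma>_def real_sqrt_divide)

  have prob: "measure_pmf.prob M {A.
      is_estimation (opt_vanilla k d P) (opt_vanilla k t (apply_lin t d A ` P)) (c * \<alpha>) \<and>
      (\<forall>C. C \<subseteq> P \<and> card C = k \<and> approx_sol k t (apply_lin t d A ` P) (apply_lin t d A ` C) \<beta>
        \<longrightarrow> approx_sol k d P C (c * \<alpha>))} \<ge> 2/3" (is "measure_pmf.prob M ?Good \<ge> _")
    if P: "P \<subseteq> Rn d" "finite P" "card P = n" for P
  proof -
    have P_ne: "P \<noteq> {}" using P(3) k kn by auto
    have opt: "0 \<le> opt_vanilla k d P"
      using d k P P_ne by (intro opt_vanilla_nonneg) auto
    \<comment> \<open>The witnesses depend on \<open>P\<close> alone and not on the sampled matrix,
      as the union bound requires.\<close>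
    obtain W S where W: "W \<subseteq> P" "card W \<le> k" "\<And>p. p \<in> P \<Longrightarrow> \<exists>c\<in>W. edist d p c \<le> 2 * opt_vanilla k d P"
      and S: "S \<subseteq> P" "card S \<le> Suc k" "pairwise (\<lambda>x y. opt_vanilla k d P \<le> edist d x y) S"
        "opt_vanilla k d P = 0 \<or> card S = Suc k"
      by (rule separated_witnesses[of d k P]) (use d k P P_ne in auto)
    define bad1 where "bad1 =
      {A. \<exists>v. enorm t (\<lambda>i. \<Sum>j<d. A i j * v j) > 16 * sqrt (real d + real t) * enorm d v}"
    define bad2 where "bad2 = {A. \<exists>x\<in>W \<union> S. \<exists>y\<in>W \<union> S.
      enorm t (\<lambda>i. \<Sum>j<d. A i j * (x j - y j)) < sqrt (real t) / 2 * edist d x y}"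
    have good: "(\<lambda>i j. \<sigma> * A i j) \<in> ?Good" if A: "A \<notin> bad1" "A \<notin> bad2" for A
    proof -
      define L where "L = apply_lin t d (\<lambda>i j. \<sigma> * A i j)"
      have edist_L: "edist t (L x) (L y) = \<sigma> * enorm t (\<lambda>i. \<Sum>j<d. A i j * (x j - y j))" for x y
        unfolding L_def using \<sigma> by (intro edist_apply_lin_scaled) simp
      have lip: "edist t (L x) (L y) \<le> 128 * \<alpha> * edist d x y" for x y
      proof -
        have "edist t (L x) (L y) \<le> \<sigma> * (16 * sqrt (real d + real t) * edist d x y)"
          unfolding edist_L using A(1) \<sigma>
          by (intro mult_left_mono) (auto simp: bad1_def not_less edist_def)
        also have "\<dots> \<le> 128 * \<alpha> * edist d x y"
          using mult_right_mono[OF expansion edist_nonneg[of d x y]] by (simp add: mult_ac)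
        finally show ?thesis .
      qed
      have expand: "2 * edist d x y \<le> edist t (L x) (L y)" if "x \<in> W \<union> S" "y \<in> W \<union> S" for x y
      proof -
        have "sqrt (real t) / 2 * edist d x y \<le> enorm t (\<lambda>i. \<Sum>j<d. A i j * (x j - y j))"
          using A(2) that unfolding bad2_def by (metis (mono_tags, lifting) mem_Collect_eq not_less)
        then have "\<sigma> * (sqrt (real t) / 2 * edist d x y) \<le> edist t (L x) (L y)"
          unfolding edist_L using \<sigma> by (intro mult_left_mono) auto
        then show ?thesis using t_pos by (simp add: \<sigma>_def)
      qed
      have L_Rn: "L x \<in> Rn t" for x by (auto simp: L_def apply_lin_def Rn_def)
      have K: "0 \<le> 128 * \<alpha>" using \<alpha> by simp
      note emb = kcenter_embedding[OF _ t_pos k P(2) P_ne P(1) L_Rn K lip W S(1,3,4) expand]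
      have "is_estimation (opt_vanilla k d P) (opt_vanilla k t (L ` P)) (2 * (128 * \<alpha>))"
        using emb(1) d by simp
      then have est: "is_estimation (opt_vanilla k d P) (opt_vanilla k t (L ` P)) (c * \<alpha>)"
        by (rule is_estimation_mono) (use \<alpha> assms opt in \<open>auto simp: c_def algebra_simps\<close>)
      have "4 + (\<beta> + 2) * (128 * \<alpha>) \<le> c * \<alpha>"
        using \<alpha> by (simp add: c_def algebra_simps)
      then have "approx_sol k d P C (c * \<alpha>)"
        if "C \<subseteq> P" "card C = k" "approx_sol k t (L ` P) (L ` C) \<beta>" for C
        by (intro approx_sol_mono[OF emb(2)[where \<beta> = \<beta>]]) (use that d assms opt in auto)
      then show ?thesis using est by (simp add: L_def)
    qed
    have "measure_pmf.prob (sign_matrix t d) bad1 \<le> exp (- 2 * (real d + real t))"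
      unfolding bad1_def by (rule sign_matrix_operator_norm) (use d t_pos in auto)
    also have "\<dots> \<le> exp (- 5)"
      using t T by simp
    finally have bad1: "measure_pmf.prob (sign_matrix t d) bad1 \<le> exp (- 5)" .
    have "finite (W \<union> S)" using W(1) S(1) P(2) by (auto intro: finite_subset)
    then have "measure_pmf.prob (sign_matrix t d) bad2 \<le> (real (card (W \<union> S)))\<^sup>2 * exp (- real t / 12)"
      unfolding bad2_def by (rule sign_matrix_noncontracting)
    \<comment> \<open>There are at most \<open>k + (k + 1) \<le> 3 * k\<close> witnesses, and
      \<open>exp (- t / 12)\<close> absorbs the factor \<open>k^2\<close>.\<close>
    also have "\<dots> \<le> (3 * real k)\<^sup>2 * (exp (- 5) / (real k)\<^sup>2)"
    proof (intro mult_mono power_mono)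
      have "card (W \<union> S) \<le> 3 * k"
        using card_Un_le[of W S] W(2) S(2) k by linarith
      then show "real (card (W \<union> S)) \<le> 3 * real k" by linarith
      have "5 + 2 * ln (real k) \<le> real t / 12"
        using t_ge ln_k by simp
      then have "exp (- real t / 12) \<le> exp (- 5 - ln ((real k)\<^sup>2))"
        using k by (simp add: ln_realpow)
      also have "\<dots> = exp (- 5) / (real k)\<^sup>2"
        using k by (simp add: exp_diff)
      finally show "exp (- real t / 12) \<le> exp (- 5) / (real k)\<^sup>2" .
    qed auto
    also have "\<dots> = 9 * exp (- 5)"
      using k by (simp add: power_mult_distrib)
    finally have bad2: "measure_pmf.prob (sign_matrix t d) bad2 \<le> 9 * exp (- 5)" .
    \<comment> \<open>The failure probabilities total at most \<open>10 * exp (- 5)\<close>;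
      \<open>exp 1 \<ge> 5 / 2\<close> brings this below \<open>1 / 3\<close>.\<close>
    have "(5 / 2) ^ 5 \<le> exp (1 :: real) ^ 5"
      using exp_lower_Taylor_quadratic[of "1 :: real"] by (intro power_mono) auto
    then have "30 \<le> exp (5 :: real)"
      by (simp add: power_divide flip: exp_of_nat_mult)
    then have e5: "10 * exp (- 5) \<le> (1 / 3 :: real)"
      by (simp add: exp_minus field_simps)
    have "1 - measure_pmf.prob (sign_matrix t d) (bad1 \<union> bad2) = measure_pmf.prob (sign_matrix t d) (- (bad1 \<union> bad2))"
      by (simp add: measure_pmf.prob_compl[symmetric] Compl_eq_Diff_UNIV)
    also have "\<dots> \<le> measure_pmf.prob (sign_matrix t d) ((\<lambda>A i j. \<sigma> * A i j) -` ?Good)"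
      by (rule measure_pmf.finite_measure_mono) (use good in blast, simp)
    also have "\<dots> = measure_pmf.prob M ?Good"
      by (simp add: M_def)
    finally show ?thesis
      using bad1 bad2 e5 measure_Un_le[of bad1 "measure_pmf (sign_matrix t d)" bad2]
      by simp
  qed
  show "\<exists>(t::nat) (M::(nat \<Rightarrow> nat \<Rightarrow> real) measure).
      real t \<le> (260 + 128 * \<beta>) * (1 + ln (real k) + real d / \<alpha>\<^sup>2) \<and>
      prob_space M \<and>
      (\<forall>P. P \<subseteq> Rn d \<and> finite P \<and> card P = n \<longrightarrow>
         measure M {A \<in> space M.
            is_estimation (opt_vanilla k d P)
                          (opt_vanilla k t (apply_lin t d A ` P)) ((260 + 128 * \<beta>) * \<alpha>) \<and>
            (\<forall>C. C \<subseteq> P \<and> card C = k \<and>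
                  approx_sol k t (apply_lin t d A ` P) (apply_lin t d A ` C) \<beta>
                  \<longrightarrow> approx_sol k d P C ((260 + 128 * \<beta>) * \<alpha>))} \<ge> 2/3)"
    unfolding c_def[symmetric]
    using t_bound prob by (intro exI[of _ t] exI[of _ "measure_pmf M"]) (auto simp: prob_space_measure_pmf)
qed

end
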